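(* Let $\kappa$ be a field, $G$ a torsion-free group and $\sigma\in pm(G)$ a factor set. Then the spectral partial action $\hat\theta$ of $G$ on $\Omega_\sigma$ is topologically free.
   Context: A partial projective $\sigma$-representation of $G$ in a unital (associative) $\kappa$-algebra $R$ (with $1_R\neq 0$) is a map $\Gamma:G\to R$ for which there is a function $\sigma:G\times G\to\kappa$ (called the factor set) such that for all $g,h\in G$: (i) if $\sigma(g,h)=0$ then $\Gamma(g^{-1})\Gamma(gh)=0$ and $\Gamma(gh)\Gamma(h^{-1})=0$; (ii) if $\Gamma(g)\Gamma(h)=0$ then $\sigma(g,h)=0$; (iii) $\Gamma(1_G)=1_R$; (iv) $\Gamma(g^{-1})\Gamma(g)\Gamma(h)=\sigma(g,h)\Gamma(g^{-1})\Gamma(gh)$; (v) $\Gamma(g)\Gamma(h)\Gamma(h^{-1})=\sigma(g,h)\Gamma(gh)\Gamma(h^{-1})$. The set of all factor sets of $G$ (over all such $R$ and $\Gamma$) is $pm(G)$. Let $\Omega=\{\xi\subseteq G:1\in\xi\}$, identified with $\prod_{g\in G\setminus\{1\}}\{0,1\}$ and given the product topology. The $\sigma$-prohibitions of type I are the sets $\{h,hg,hgs\}$ with $h,g,s\in G$ and $\sigma(g,s)=0$; those of type II are the sets $\{h,hg,hgs,hgst\}$ with $h,g,s,t\in G$ and $\sigma(g,st)\sigma(s,t)\neq\sigma(g,s)\sigma(gs,t)$. $\mathcal{P}_\sigma$ is the set of all $\sigma$-prohibitions, and $\Omega_\sigma=\{\xi\in\Omega: V\nsubseteq\xi\text{ for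 all }V\in\mathcal{P}_\sigma\}$ with the subspace topology. The spectral partial action $\hat\theta$ of $G$ on $\Omega_\sigma$ is given by the clopen sets $\hat D_g=\{\xi\in\Omega_\sigma:g\in\xi\}$ and the homeomorphisms $\hat\theta_g:\hat D_{g^{-1}}\to\hat D_g$, $\hat\theta_g(\xi)=g\xi$. A topological partial action $(\{X_g\},\{\theta_g:X_{g^{-1}}\to X_g\})$ of $G$ on a space $X$ is topologically free if for every $g\neq1_G$ the set $\{x\in X_{g^{-1}}:\theta_g(x)=x\}$ has empty interior. *)

theory Defs
  imports "HOL-Analysis.Analysis" "HOL-Algebra.Coset" "HOL-Algebra.Module"
begin

section \<open>Partial projective representations and their factor sets\<close>

text \<open>
  The locale \<^locale>\<open>algebra\<close> of \<^theory>\<open>HOL-Algebra.Module\<close> only covers commutative algebras;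
  here the multiplication of \<open>R\<close> need not commute.
\<close>

locale unital_algebra = module K R + ring R
  for K :: "('k, 'm) ring_scheme" (structure) and R :: "('k, 'r) module" (structure) +
  assumes smult_mult_left:
      "\<lbrakk>a \<in> carrier K; x \<in> carrier R; y \<in> carrier R\<rbrakk>
        \<Longrightarrow> (a \<odot>\<^bsub>R\<^esub> x) \<otimes>\<^bsub>R\<^esub> y = a \<odot>\<^bsub>R\<^esub> (x \<otimes>\<^bsub>R\<^esub> y)"
    and smult_mult_right:
      "\<lbrakk>a \<in> carrier K; x \<in> carrier R; y \<in> carrier R\<rbrakk>
        \<Longrightarrow> x \<otimes>\<^bsub>R\<^esub> (a \<odot>\<^bsub>R\<^esub> y) = a \<odot>\<^bsub>R\<^esub> (x \<otimes>\<^bsub>R\<^esub> y)"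
    and one_neq_zero: "\<one>\<^bsub>R\<^esub> \<noteq> \<zero>\<^bsub>R\<^esub>"

locale partial_projective_rep = field K + group G + unital_algebra K R
  for K :: "('k, 'm) ring_scheme" and G :: "('g, 'n) monoid_scheme"
    and R :: "('k, 'r) module"
    and \<Gamma> :: "'g \<Rightarrow> 'r" and \<sigma> :: "'g \<times> 'g \<Rightarrow> 'k" +
  assumes rep_closed: "\<Gamma> \<in> carrier G \<rightarrow> carrier R"
    and factor_closed: "\<sigma> \<in> carrier G \<times> carrier G \<rightarrow> carrier K"
    and factor_zero:
      "\<lbrakk>g \<in> carrier G; h \<in> carrier G; \<sigma> (g, h) = \<zero>\<^bsub>K\<^esub>\<rbrakk>
        \<Longrightarrow> \<Gamma> (inv\<^bsub>G\<^esub> g) \<otimes>\<^bsub>R\<^esub> \<Gamma> (g \<otimes>\<^bsub>G\<^esub> h) = \<zero>\<^bsub>R\<^esub>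
          \<and> \<Gamma> (g \<otimes>\<^bsub>G\<^esub> h) \<otimes>\<^bsub>R\<^esub> \<Gamma> (inv\<^bsub>G\<^esub> h) = \<zero>\<^bsub>R\<^esub>"
    and rep_mult_zero:
      "\<lbrakk>g \<in> carrier G; h \<in> carrier G; \<Gamma> g \<otimes>\<^bsub>R\<^esub> \<Gamma> h = \<zero>\<^bsub>R\<^esub>\<rbrakk> \<Longrightarrow> \<sigma> (g, h) = \<zero>\<^bsub>K\<^esub>"
    and rep_one: "\<Gamma> \<one>\<^bsub>G\<^esub> = \<one>\<^bsub>R\<^esub>"
    and rep_mult_left:
      "\<lbrakk>g \<in> carrier G; h \<in> carrier G\<rbrakk>
        \<Longrightarrow> \<Gamma> (inv\<^bsub>G\<^esub> g) \<otimes>\<^bsub>R\<^esub> \<Gamma> g \<otimes>\<^bsub>R\<^esub> \<Gamma> h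
          = \<sigma> (g, h) \<odot>\<^bsub>R\<^esub> (\<Gamma> (inv\<^bsub>G\<^esub> g) \<otimes>\<^bsub>R\<^esub> \<Gamma> (g \<otimes>\<^bsub>G\<^esub> h))"
    and rep_mult_right:
      "\<lbrakk>g \<in> carrier G; h \<in> carrier G\<rbrakk>
        \<Longrightarrow> \<Gamma> g \<otimes>\<^bsub>R\<^esub> \<Gamma> h \<otimes>\<^bsub>R\<^esub> \<Gamma> (inv\<^bsub>G\<^esub> h)
          = \<sigma> (g, h) \<odot>\<^bsub>R\<^esub> (\<Gamma> (g \<otimes>\<^bsub>G\<^esub> h) \<otimes>\<^bsub>R\<^esub> \<Gamma> (inv\<^bsub>G\<^esub> h))"

text \<open>
  HOL cannot quantify over types inside a formula, so the type \<open>'r\<close> from which the algebras \<open>R\<close>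
  are taken is a parameter of \<open>pm\<close>. A theorem with the hypothesis \<open>\<sigma> \<in> pm TYPE('r) K G\<close> for a
  type variable \<open>'r\<close> covers the factor sets arising from algebras over every type.
  The values of \<open>\<sigma>\<close> outside \<open>carrier G \<times> carrier G\<close> are unconstrained and never used.
\<close>

definition pm ::
    "'r itself \<Rightarrow> ('k, 'm) ring_scheme \<Rightarrow> ('g, 'n) monoid_scheme \<Rightarrow> ('g \<times> 'g \<Rightarrow> 'k) set" where
  "pm (_ :: 'r itself) K G =
    {\<sigma>. \<exists>(R :: ('k, 'r) module) \<Gamma>. partial_projective_rep K G R \<Gamma> \<sigma>}"

definition torsion_free_group :: "('g, 'n) monoid_scheme \<Rightarrow> bool" where
  "torsion_free_group G \<longleftrightarrow> group G \<and>
    (\<forall>g \<in> carrier G. \<forall>n::nat. g \<noteq> \<one>\<^bsub>G\<^esub> \<and> n > 0 \<longrightarrow> g [^]\<^bsub>G\<^esub> n \<noteq> \<one>\<^bsub>G\<^esub>)"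


section \<open>Topological partial actions\<close>

text \<open>
  A partial map \<open>\<theta>\<^sub>g : X\<^sub>g\<^sub>-\<^sub>1 \<rightarrow> X\<^sub>g\<close> is represented by a total function \<open>\<theta> g\<close> of which only the
  values on \<open>X (inv g)\<close> matter.
\<close>

locale topological_partial_action = group G
  for G :: "('g, 'n) monoid_scheme" (structure) and T :: "'x topology"
    and X :: "'g \<Rightarrow> 'x set" and \<theta> :: "'g \<Rightarrow> 'x \<Rightarrow> 'x" +
  assumes open_domain: "g \<in> carrier G \<Longrightarrow> openin T (X g)"
    and homeomorphism: "g \<in> carrier G
      \<Longrightarrow> homeomorphic_map (subtopology T (X (inv g))) (subtopology T (X g)) (\<theta> g)"
    and domain_one: "X \<one> = topspace T"
    and action_one: "x \<in> topspace T \<Longrightarrow> \<theta> \<one> x = x"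
    and action_domain: "\<lbrakk>g \<in> carrier G; h \<in> carrier G\<rbrakk>
      \<Longrightarrow> \<theta> g ` (X (inv g) \<inter> X h) = X g \<inter> X (g \<otimes> h)"
    and action_mult: "\<lbrakk>g \<in> carrier G; h \<in> carrier G; x \<in> X (inv h) \<inter> X (inv (g \<otimes> h))\<rbrakk>
      \<Longrightarrow> \<theta> g (\<theta> h x) = \<theta> (g \<otimes> h) x"

definition topologically_free ::
    "('g, 'n) monoid_scheme \<Rightarrow> 'x topology \<Rightarrow> ('g \<Rightarrow> 'x set) \<Rightarrow> ('g \<Rightarrow> 'x \<Rightarrow> 'x) \<Rightarrow> bool" where
  "topologically_free G T X \<theta> \<longleftrightarrow> topological_partial_action G T X \<theta> \<and>
    (\<forall>g \<in> carrier G. g \<noteq> \<one>\<^bsub>G\<^esub> \<longrightarrow> T interior_of {x \<in> X (inv\<^bsub>G\<^esub> g). \<theta> g x = x} = {})"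


section \<open>The spectral partial action\<close>

definition Omega :: "('g, 'n) monoid_scheme \<Rightarrow> 'g set set" where
  "Omega G = {\<xi>. \<xi> \<subseteq> carrier G \<and> \<one>\<^bsub>G\<^esub> \<in> \<xi>}"

text \<open>
  The topology is transported from the product along the identification of \<open>\<xi>\<close> with its indicator
  function on \<open>G - {1}\<close>; the two-point set is \<^typ>\<open>bool\<close>.
\<close>

definition Omega_topology :: "('g, 'n) monoid_scheme \<Rightarrow> 'g set topology" where
  "Omega_topology G =
    pullback_topology (Omega G) (\<lambda>\<xi>. \<lambda>g \<in> carrier G - {\<one>\<^bsub>G\<^esub>}. g \<in> \<xi>)
      (product_topology (\<lambda>_. discrete_topology (UNIV :: bool set)) (carrier G - {\<one>\<^bsub>G\<^esub>}))"

definition prohibitions_I ::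
    "('k, 'm) ring_scheme \<Rightarrow> ('g, 'n) monoid_scheme \<Rightarrow> ('g \<times> 'g \<Rightarrow> 'k) \<Rightarrow> 'g set set" where
  "prohibitions_I K G \<sigma> =
    {{h, h \<otimes>\<^bsub>G\<^esub> g, h \<otimes>\<^bsub>G\<^esub> g \<otimes>\<^bsub>G\<^esub> s} | h g s.
      h \<in> carrier G \<and> g \<in> carrier G \<and> s \<in> carrier G \<and> \<sigma> (g, s) = \<zero>\<^bsub>K\<^esub>}"

definition prohibitions_II ::
    "('k, 'm) ring_scheme \<Rightarrow> ('g, 'n) monoid_scheme \<Rightarrow> ('g \<times> 'g \<Rightarrow> 'k) \<Rightarrow> 'g set set" where
  "prohibitions_II K G \<sigma> =
    {{h, h \<otimes>\<^bsub>G\<^esub> g, h \<otimes>\<^bsub>G\<^esub> g \<otimes>\<^bsub>G\<^esub> s, h \<otimes>\<^bsub>G\<^esub> g \<otimes>\<^bsub>G\<^esub> s \<otimes>\<^bsub>G\<^esub> t} | h g s t.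
      h \<in> carrier G \<and> g \<in> carrier G \<and> s \<in> carrier G \<and> t \<in> carrier G \<and>
      \<sigma> (g, s \<otimes>\<^bsub>G\<^esub> t) \<otimes>\<^bsub>K\<^esub> \<sigma> (s, t) \<noteq> \<sigma> (g, s) \<otimes>\<^bsub>K\<^esub> \<sigma> (g \<otimes>\<^bsub>G\<^esub> s, t)}"

definition prohibitions ::
    "('k, 'm) ring_scheme \<Rightarrow> ('g, 'n) monoid_scheme \<Rightarrow> ('g \<times> 'g \<Rightarrow> 'k) \<Rightarrow> 'g set set" where
  "prohibitions K G \<sigma> = prohibitions_I K G \<sigma> \<union> prohibitions_II K G \<sigma>"

definition Omega_sigma ::
    "('k, 'm) ring_scheme \<Rightarrow> ('g, 'n) monoid_scheme \<Rightarrow> ('g \<times> 'g \<Rightarrow> 'k) \<Rightarrow> 'g set set" where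
  "Omega_sigma K G \<sigma> = {\<xi> \<in> Omega G. \<forall>V \<in> prohibitions K G \<sigma>. \<not> V \<subseteq> \<xi>}"

definition Omega_sigma_topology ::
    "('k, 'm) ring_scheme \<Rightarrow> ('g, 'n) monoid_scheme \<Rightarrow> ('g \<times> 'g \<Rightarrow> 'k) \<Rightarrow> 'g set topology" where
  "Omega_sigma_topology K G \<sigma> = subtopology (Omega_topology G) (Omega_sigma K G \<sigma>)"

definition spectral_domain ::
    "('k, 'm) ring_scheme \<Rightarrow> ('g, 'n) monoid_scheme \<Rightarrow> ('g \<times> 'g \<Rightarrow> 'k) \<Rightarrow> 'g \<Rightarrow> 'g set set" where
  "spectral_domain K G \<sigma> g = {\<xi> \<in> Omega_sigma K G \<sigma>. g \<in> \<xi>}"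

definition spectral_action :: "('g, 'n) monoid_scheme \<Rightarrow> 'g \<Rightarrow> 'g set \<Rightarrow> 'g set" where
  "spectral_action G g \<xi> = g <#\<^bsub>G\<^esub> \<xi>"

lemma topspace_Omega: "topspace (Omega_topology G) = Omega G"
  by (auto simp: Omega_topology_def topspace_pullback_topology)

lemma topspace_Omega_sigma: "topspace (Omega_sigma_topology K G \<sigma>) = Omega_sigma K G \<sigma>"
  by (auto simp: Omega_sigma_topology_def topspace_Omega Omega_sigma_def)

lemma continuous_map_member:
  assumes "a \<in> carrier G"
  shows "continuous_map (Omega_topology G) (discrete_topology (UNIV :: bool set)) (\<lambda>\<xi>. a \<in> \<xi>)"
proof (cases "a = \<one>\<^bsub>G\<^esub>")
  case True
  have "continuous_map (Omega_topology G) (discrete_topology (UNIV :: bool set)) (\<lambda>\<xi>. True)"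
    by simp
  then show ?thesis
    by (rule continuous_map_eq) (auto simp: topspace_Omega Omega_def True)
next
  case False
  let ?I = "carrier G - {\<one>\<^bsub>G\<^esub>}"
  have a: "a \<in> ?I" using assms False by simp
  have "continuous_map (product_topology (\<lambda>_. discrete_topology (UNIV :: bool set)) ?I)
          (discrete_topology (UNIV :: bool set)) (\<lambda>x. x a)"
    by (rule continuous_map_product_projection[OF a])
  then have "continuous_map (Omega_topology G) (discrete_topology (UNIV :: bool set))
          ((\<lambda>x. x a) \<circ> (\<lambda>\<xi>. \<lambda>g \<in> ?I. g \<in> \<xi>))"
    unfolding Omega_topology_def by (rule continuous_map_pullback)
  then show ?thesis using a by (simp add: o_def)
qed

context group
begin

lemma mem_l_coset:
  assumes "\<xi> \<subseteq> carrier G" "g \<in> carrier G" "k \<in> carrier G"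
  shows "k \<in> g <# \<xi> \<longleftrightarrow> inv g \<otimes> k \<in> \<xi>"
proof
  assume "k \<in> g <# \<xi>"
  then obtain h where h: "h \<in> \<xi>" "k = g \<otimes> h" by (auto simp: l_coset_def)
  then show "inv g \<otimes> k \<in> \<xi>" using assms by (metis inv_solve_left subsetD)
next
  assume "inv g \<otimes> k \<in> \<xi>"
  moreover have "k = g \<otimes> (inv g \<otimes> k)" using assms by (simp add: m_assoc[symmetric])
  ultimately show "k \<in> g <# \<xi>" unfolding l_coset_def by blast
qed

lemma prohibitions_translate:
  assumes "V \<in> prohibitions K G \<sigma>" "g \<in> carrier G"
  shows "g <# V \<in> prohibitions K G \<sigma>"
  using assms(1) unfolding prohibitions_def
proof
  assume "V \<in> prohibitions_I K G \<sigma>"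
  then obtain h a s where *: "h \<in> carrier G" "a \<in> carrier G" "s \<in> carrier G"
      "\<sigma> (a, s) = \<zero>\<^bsub>K\<^esub>" "V = {h, h \<otimes> a, h \<otimes> a \<otimes> s}"
    unfolding prohibitions_I_def by blast
  have "g <# V = {g \<otimes> h, (g \<otimes> h) \<otimes> a, (g \<otimes> h) \<otimes> a \<otimes> s}"
    unfolding * l_coset_def using * assms(2) by (auto simp: m_assoc)
  then have "g <# V \<in> prohibitions_I K G \<sigma>"
    unfolding prohibitions_I_def using * assms(2) by blast
  then show "g <# V \<in> prohibitions_I K G \<sigma> \<union> prohibitions_II K G \<sigma>" ..
next
  assume "V \<in> prohibitions_II K G \<sigma>"
  then obtain h a s t where *: "h \<in> carrier G" "a \<in> carrier G" "s \<in> carrier G" "t \<in> carrier G"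
      "\<sigma> (a, s \<otimes> t) \<otimes>\<^bsub>K\<^esub> \<sigma> (s, t) \<noteq> \<sigma> (a, s) \<otimes>\<^bsub>K\<^esub> \<sigma> (a \<otimes> s, t)"
      "V = {h, h \<otimes> a, h \<otimes> a \<otimes> s, h \<otimes> a \<otimes> s \<otimes> t}"
    unfolding prohibitions_II_def by blast
  have "g <# V = {g \<otimes> h, (g \<otimes> h) \<otimes> a, (g \<otimes> h) \<otimes> a \<otimes> s, (g \<otimes> h) \<otimes> a \<otimes> s \<otimes> t}"
    unfolding * l_coset_def using * assms(2) by (auto simp: m_assoc)
  then have "g <# V \<in> prohibitions_II K G \<sigma>"
    unfolding prohibitions_II_def using * assms(2) by blast
  then show "g <# V \<in> prohibitions_I K G \<sigma> \<union> prohibitions_II K G \<sigma>" ..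
qed

lemma l_coset_inverse:
  assumes "\<xi> \<subseteq> carrier G" "g \<in> carrier G"
  shows "inv g <# (g <# \<xi>) = \<xi>"
  using assms by (simp add: lcos_m_assoc lcos_mult_one)

lemma spectral_action_closed:
  assumes g: "g \<in> carrier G" and \<xi>: "\<xi> \<in> spectral_domain K G \<sigma> (inv g)"
  shows "spectral_action G g \<xi> \<in> spectral_domain K G \<sigma> g"
proof -
  have sub: "\<xi> \<subseteq> carrier G" and one: "\<one> \<in> \<xi>" and ginv: "inv g \<in> \<xi>"
    and pro: "\<And>V. V \<in> prohibitions K G \<sigma> \<Longrightarrow> \<not> V \<subseteq> \<xi>"
    using \<xi> by (auto simp: spectral_domain_def Omega_sigma_def Omega_def)
  have "\<not> V \<subseteq> g <# \<xi>" if V: "V \<in> prohibitions K G \<sigma>" for V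
  proof
    assume "V \<subseteq> g <# \<xi>"
    then have "inv g <# V \<subseteq> inv g <# (g <# \<xi>)" by (auto simp: l_coset_def)
    then have "inv g <# V \<subseteq> \<xi>" using l_coset_inverse[OF sub g] by simp
    moreover have "inv g <# V \<in> prohibitions K G \<sigma>" using prohibitions_translate V g by blast
    ultimately show False using pro by blast
  qed
  moreover have "\<one> \<in> g <# \<xi>" "g \<in> g <# \<xi>" 
    using mem_l_coset[OF sub g] g one ginv by simp_all
  moreover have "g <# \<xi> \<subseteq> carrier G" by (rule l_coset_subset_G[OF sub g])
  ultimately show ?thesis
    by (auto simp: spectral_action_def spectral_domain_def Omega_sigma_def Omega_def)
qed

lemma spectral_action_continuous:
  assumes g: "g \<in> carrier G"
  shows "continuous_map
    (subtopology (Omega_sigma_topology K G \<sigma>) (spectral_domain K G \<sigma> (inv g)))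
    (subtopology (Omega_sigma_topology K G \<sigma>) (spectral_domain K G \<sigma> g)) (spectral_action G g)"
proof -
  let ?S = "subtopology (Omega_sigma_topology K G \<sigma>) (spectral_domain K G \<sigma> (inv g))"
  let ?I = "carrier G - {\<one>}"
  have S: "topspace ?S = spectral_domain K G \<sigma> (inv g)"
    by (auto simp: topspace_Omega_sigma spectral_domain_def)
  have closed: "spectral_action G g \<in> topspace ?S \<rightarrow> spectral_domain K G \<sigma> g"
    unfolding S using spectral_action_closed[OF g] by blast
  have dom: "spectral_domain K G \<sigma> g \<subseteq> Omega_sigma K G \<sigma>" "Omega_sigma K G \<sigma> \<subseteq> Omega G"
    by (auto simp: spectral_domain_def Omega_sigma_def)
  have comp: "continuous_map ?S (discrete_topology UNIV) (\<lambda>\<xi>. k \<in> spectral_action G g \<xi>)"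
    if k: "k \<in> carrier G" for k
  proof -
    have "continuous_map ?S (discrete_topology UNIV) (\<lambda>\<xi>. inv g \<otimes> k \<in> \<xi>)"
      unfolding Omega_sigma_topology_def using g k
      by (intro continuous_map_from_subtopology continuous_map_member) simp
    then show ?thesis
    proof (rule continuous_map_eq)
      fix \<xi> assume "\<xi> \<in> topspace ?S"
      then have "\<xi> \<subseteq> carrier G" unfolding S by (auto simp: spectral_domain_def Omega_sigma_def Omega_def)
      then show "(inv g \<otimes> k \<in> \<xi>) = (k \<in> spectral_action G g \<xi>)"
        using mem_l_coset g k by (simp add: spectral_action_def)
    qed
  qed
  have "continuous_map ?S (Omega_topology G) (spectral_action G g)"
    unfolding Omega_topology_def
  proof (rule continuous_map_pullback')
    show "continuous_map ?S (product_topology (\<lambda>_. discrete_topology UNIV) ?I)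
        ((\<lambda>\<xi>. \<lambda>k\<in>?I. k \<in> \<xi>) \<circ> spectral_action G g)"
      unfolding continuous_map_componentwise using comp by (auto simp: o_def)
    show "topspace ?S \<subseteq> spectral_action G g -` Omega G" using closed dom by blast
  qed
  then show ?thesis
    unfolding Omega_sigma_topology_def continuous_map_in_subtopology
    using closed dom unfolding Omega_sigma_topology_def by blast
qed

lemma spectral_action_inverse:
  assumes "g \<in> carrier G" "\<xi> \<in> Omega_sigma K G \<sigma>"
  shows "spectral_action G (inv g) (spectral_action G g \<xi>) = \<xi>"
  using assms l_coset_inverse by (auto simp: spectral_action_def Omega_sigma_def Omega_def)

text \<open>The spectral data form a partial action for every \<open>\<sigma>\<close>, factor set or not.\<close>

proposition topological_partial_action_spectral:
  "topological_partial_action G (Omega_sigma_topology K G \<sigma>)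
    (spectral_domain K G \<sigma>) (spectral_action G)"
proof unfold_locales
  let ?T = "Omega_sigma_topology K G \<sigma>" and ?X = "spectral_domain K G \<sigma>"
  fix g assume g: "g \<in> carrier G"
  have "continuous_map ?T (discrete_topology UNIV) (\<lambda>\<xi>. g \<in> \<xi>)"
    unfolding Omega_sigma_topology_def
    by (intro continuous_map_from_subtopology continuous_map_member g)
  then have "openin ?T {\<xi> \<in> topspace ?T. (g \<in> \<xi>) \<in> {True}}"
    by (rule openin_continuous_map_preimage) simp
  then show "openin ?T (?X g)" by (simp add: topspace_Omega_sigma spectral_domain_def)
  have "homeomorphic_maps (subtopology ?T (?X (inv g))) (subtopology ?T (?X g))
      (spectral_action G g) (spectral_action G (inv g))"
    unfolding homeomorphic_maps_def
    using spectral_action_continuous[OF g, of K \<sigma>]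
      spectral_action_continuous[OF inv_closed[OF g], of K \<sigma>]
      spectral_action_inverse[OF g, of _ K \<sigma>]
      spectral_action_inverse[OF inv_closed[OF g], of _ K \<sigma>] g
    by (auto simp: topspace_Omega_sigma)
  then show "homeomorphic_map (subtopology ?T (?X (inv g))) (subtopology ?T (?X g))
      (spectral_action G g)"
    using homeomorphic_maps_map by blast
next
  show "spectral_domain K G \<sigma> \<one> = topspace (Omega_sigma_topology K G \<sigma>)"
    by (auto simp: topspace_Omega_sigma spectral_domain_def Omega_sigma_def Omega_def)
next
  fix \<xi> assume "\<xi> \<in> topspace (Omega_sigma_topology K G \<sigma>)"
  then show "spectral_action G \<one> \<xi> = \<xi>"
    by (auto simp: topspace_Omega_sigma Omega_sigma_def Omega_def spectral_action_def lcos_mult_one)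
next
  let ?X = "spectral_domain K G \<sigma>" and ?\<theta> = "spectral_action G"
  fix g h assume g: "g \<in> carrier G" and h: "h \<in> carrier G"
  have X: "\<xi> \<in> ?X a \<longleftrightarrow> \<xi> \<in> Omega_sigma K G \<sigma> \<and> a \<in> \<xi>" for \<xi> a
    by (simp add: spectral_domain_def)
  have sub: "\<xi> \<subseteq> carrier G" if "\<xi> \<in> Omega_sigma K G \<sigma>" for \<xi>
    using that by (simp add: Omega_sigma_def Omega_def)
  have to: "?\<theta> g \<xi> \<in> ?X g \<inter> ?X (g \<otimes> h)" if "\<xi> \<in> ?X (inv g) \<inter> ?X h" for \<xi>
  proof -
    have "inv g \<otimes> (g \<otimes> h) = h" using g h by (simp add: m_assoc[symmetric])
    then have "g \<otimes> h \<in> ?\<theta> g \<xi>"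
      using that mem_l_coset[of \<xi> g "g \<otimes> h"] sub g h by (auto simp: X spectral_action_def)
    then show ?thesis using spectral_action_closed[OF g, of \<xi> K \<sigma>] that by (auto simp: X)
  qed
  have from_: "?\<theta> (inv g) \<eta> \<in> ?X (inv g) \<inter> ?X h" if "\<eta> \<in> ?X g \<inter> ?X (g \<otimes> h)" for \<eta>
  proof -
    have "h \<in> ?\<theta> (inv g) \<eta>"
      using that mem_l_coset[of \<eta> "inv g" h] sub g h by (auto simp: X spectral_action_def)
    then show ?thesis using spectral_action_closed[OF inv_closed[OF g], of \<eta> K \<sigma>] that g
      by (auto simp: X)
  qed
  have "\<eta> \<in> ?\<theta> g ` (?X (inv g) \<inter> ?X h)" if "\<eta> \<in> ?X g \<inter> ?X (g \<otimes> h)" for \<eta>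
  proof
    show "\<eta> = ?\<theta> g (?\<theta> (inv g) \<eta>)"
      using spectral_action_inverse[OF inv_closed[OF g], of \<eta> K \<sigma>] that g by (simp add: X)
  qed (rule from_[OF that])
  then show "?\<theta> g ` (?X (inv g) \<inter> ?X h) = ?X g \<inter> ?X (g \<otimes> h)" using to by blast
  fix \<xi> assume "\<xi> \<in> ?X (inv h) \<inter> ?X (inv (g \<otimes> h))"
  then show "?\<theta> g (?\<theta> h \<xi>) = ?\<theta> (g \<otimes> h) \<xi>"
    using sub g h by (simp add: X spectral_action_def lcos_m_assoc)
qed

end

end

theory Submission
  imports Defs
begin

text \<open>
  \<open>\<Omega>\<^sub>\<sigma>\<close> is closed under passing to subsets containing \<open>1\<close>, so the finite configurations are dense
  in it. A point fixed by \<open>g\<close> contains all powers of \<open>g\<close>, hence is infinite when \<open>g\<close> has infinite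
  order; therefore no nonempty open set consists of fixed points.
\<close>

lemma Omega_sigma_mono:
  assumes "\<xi> \<in> Omega_sigma K G \<sigma>" "\<eta> \<in> Omega G" "\<eta> \<subseteq> \<xi>"
  shows "\<eta> \<in> Omega_sigma K G \<sigma>"
  using assms unfolding Omega_sigma_def by blast

text \<open>A basic neighbourhood of \<open>\<xi>\<close> in the product topology restricts only
  finitely many coordinates, so elements of \<open>\<xi>\<close> at the other coordinates may be
  dropped. Since elements are only removed, \<open>\<eta> \<subseteq> \<xi>\<close>, which later
  keeps \<open>\<eta>\<close> free of prohibitions.\<close>

lemma openin_Omega_topology_finite_mem:
  assumes U: "openin (Omega_topology G) U" and \<xi>: "\<xi> \<in> U"
  obtains \<eta> where "\<eta> \<in> U" "\<eta> \<subseteq> \<xi>" "finite \<eta>"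
proof -
  let ?I = "carrier G - {\<one>\<^bsub>G\<^esub>}"
  let ?f = "\<lambda>\<xi>. \<lambda>g \<in> ?I. g \<in> \<xi>"
  obtain V where V: "openin (product_topology (\<lambda>_. discrete_topology (UNIV :: bool set)) ?I) V"
    and UV: "U = ?f -` V \<inter> Omega G"
    using U unfolding Omega_topology_def openin_pullback_topology by blast
  have \<xi>': "?f \<xi> \<in> V" "\<xi> \<subseteq> carrier G" "\<one>\<^bsub>G\<^esub> \<in> \<xi>"
    using \<xi> unfolding UV by (auto simp: Omega_def)
  obtain W where fin: "finite {i \<in> ?I. W i \<noteq> UNIV}"
    and mem: "?f \<xi> \<in> Pi\<^sub>E ?I W" and WV: "Pi\<^sub>E ?I W \<subseteq> V"
    using V \<xi>'(1) unfolding openin_product_topology_alt by auto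
  \<comment> \<open>Keep the elements of \<open>\<xi>\<close> at restricted coordinates. The
    identity is not a coordinate, so inserting it puts \<open>\<eta>\<close> in
    \<open>Omega G\<close> without changing the indicator function.\<close>
  define \<eta> where "\<eta> = insert \<one>\<^bsub>G\<^esub> {i \<in> \<xi> \<inter> ?I. W i \<noteq> UNIV}"
  have "?f \<eta> \<in> Pi\<^sub>E ?I W"
  proof (rule PiE_I)
    fix i assume i: "i \<in> ?I"
    show "?f \<eta> i \<in> W i"
    proof (cases "W i = UNIV")
      case False
      then have "?f \<eta> i = ?f \<xi> i" using i by (simp add: \<eta>_def)
      also have "\<dots> \<in> W i" by (rule PiE_mem[OF mem i])
      finally show ?thesis .
    qed simp
  qed auto
  then have "?f \<eta> \<in> V" using WV by blast
  moreover have "\<eta> \<in> Omega G" using \<xi>'(2,3) by (auto simp: Omega_def \<eta>_def)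
  ultimately have "\<eta> \<in> U" by (simp add: UV)
  moreover have "finite \<eta>" unfolding \<eta>_def by (auto intro: finite_subset[OF _ fin])
  moreover have "\<eta> \<subseteq> \<xi>" using \<xi>'(3) by (auto simp: \<eta>_def)
  ultimately show thesis using that by blast
qed

text \<open>Shrink inside an open set \<open>V\<close> of the full space that traces out
  \<open>U\<close>; heredity of \<open>Omega_sigma\<close> then returns the finite subset to
  \<open>U\<close>.\<close>

lemma openin_Omega_sigma_topology_finite_mem:
  assumes "openin (Omega_sigma_topology K G \<sigma>) U" "\<xi> \<in> U"
  obtains \<eta> where "\<eta> \<in> U" "finite \<eta>"
proof -
  obtain V where V: "openin (Omega_topology G) V" and UV: "U = V \<inter> Omega_sigma K G \<sigma>"
    using assms(1) unfolding Omega_sigma_topology_def openin_subtopology by blast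
  obtain \<eta> where "\<eta> \<in> V" "\<eta> \<subseteq> \<xi>" "finite \<eta>"
    using openin_Omega_topology_finite_mem[OF V] assms(2) UV by blast
  moreover have "\<eta> \<in> Omega_sigma K G \<sigma>"
    using Omega_sigma_mono[of \<xi> K G \<sigma> \<eta>] calculation openin_subset[OF V] assms(2)
    by (auto simp: UV topspace_Omega)
  ultimately show thesis using that UV by blast
qed

lemma (in group) infinite_invariant_set:
  assumes g: "g \<in> carrier G" and ord: "\<And>n::nat. n > 0 \<Longrightarrow> g [^] n \<noteq> \<one>"
    and one: "\<one> \<in> \<xi>" and fixed: "g <#\<^bsub>G\<^esub> \<xi> = \<xi>"
  shows "infinite \<xi>"
proof
  assume "finite \<xi>"
  have pow: "g [^] n \<in> \<xi>" for n :: nat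
  proof (induction n)
    case (Suc n)
    have "g \<otimes> g [^] n \<in> g <#\<^bsub>G\<^esub> \<xi>" using Suc by (auto simp: l_coset_def)
    \<comment> \<open>\<open>nat_pow_Suc2\<close> puts the new factor on the left, where the
      invariance of \<open>\<xi>\<close> under left translation applies.\<close>
    then show ?case unfolding fixed nat_pow_Suc2[OF g] .
  qed (simp add: one)
  have "inj (\<lambda>n::nat. g [^] n)"
  proof (rule linorder_injI)
    fix m n :: nat assume "m < n"
    then have "g [^] n = g [^] m \<otimes> g [^] (n - m)" using g by (simp add: nat_pow_mult)
    \<comment> \<open>Equal powers would, after cancelling \<open>g [^] m\<close>, give
      \<open>g [^] (n - m) = \<one>\<close> with a positive exponent.\<close>
    then show "g [^] m \<noteq> g [^] n" using ord[of "n - m"] g \<open>m < n\<close> by simp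
  qed
  then have "infinite (range (\<lambda>n::nat. g [^] n))" by (simp add: range_inj_infinite)
  moreover have "range (\<lambda>n::nat. g [^] n) \<subseteq> \<xi>" using pow by blast
  ultimately show False using \<open>finite \<xi>\<close> finite_subset by blast
qed

theorem proposition8p7:
  fixes K :: "('k, 'm) ring_scheme" and G :: "('g, 'n) monoid_scheme"
    and \<sigma> :: "'g \<times> 'g \<Rightarrow> 'k"
  assumes "field K"
    and "torsion_free_group G"
    and "\<sigma> \<in> pm TYPE('r) K G"
  shows "topologically_free G (Omega_sigma_topology K G \<sigma>)
    (spectral_domain K G \<sigma>) (spectral_action G)"
proof -
  interpret group G using assms(2) by (simp add: torsion_free_group_def)
  let ?T = "Omega_sigma_topology K G \<sigma>"
  have "?T interior_of {\<xi> \<in> spectral_domain K G \<sigma> (inv\<^bsub>G\<^esub> g). spectral_action G g \<xi> = \<xi>} = {}"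
    (is "?T interior_of ?F = {}") if g: "g \<in> carrier G" "g \<noteq> \<one>\<^bsub>G\<^esub>" for g
  proof (rule ccontr)
    assume "?T interior_of ?F \<noteq> {}"
    \<comment> \<open>The interior is itself open, so being nonempty it has a finite member, and
      that member is a fixed point of \<open>g\<close>.\<close>
    then obtain \<eta> where \<eta>: "\<eta> \<in> ?T interior_of ?F" and fin: "finite \<eta>"
      using openin_Omega_sigma_topology_finite_mem[OF openin_interior_of] by blast
    have "\<eta> \<in> ?F" by (rule subsetD[OF interior_of_subset \<eta>])
    then have "\<one>\<^bsub>G\<^esub> \<in> \<eta>" "g <#\<^bsub>G\<^esub> \<eta> = \<eta>"
      by (auto simp: spectral_domain_def Omega_sigma_def Omega_def spectral_action_def)
    moreover have "g [^]\<^bsub>G\<^esub> n \<noteq> \<one>\<^bsub>G\<^esub>" if "n > 0" for n :: nat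
      using assms(2) g that by (simp add: torsion_free_group_def)
    ultimately have "infinite \<eta>" using infinite_invariant_set[OF g(1)] by blast
    then show False using fin by blast
  qed
  then show ?thesis
    unfolding topologically_free_def using topological_partial_action_spectral by blast
qed

end
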